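(* Let $\mathcal{M}=(\Phi,\mathcal{W},C,P)$ be a many-to-one matching market in which every firm has a path-independent choice function, fix an Aizerman–Malishevski decomposition of each firm's choice function, and let $M=(\mathcal{F},\mathcal{W},(\overline{P}_w)_{w\in\mathcal{W}},(P_{ij})_{i\in I,j\in J_i})$ be the associated one-to-one market. Let $\lambda_{\mathcal{F}}$ be the output of the adapted firm-copies-proposing deferred acceptance algorithm applied to $M$. Then $\lambda_{\mathcal{F}}$ is a stable* matching of $M$.
   Context: **Many-to-one market.** $\Phi=\{\varphi_1,\dots,\varphi_n\}$ is a finite set of firms, $I=\{1,\dots,n\}$, and $\mathcal{W}$ is a finite set of workers. Each firm $\varphi$ has a choice function $C_\varphi:2^{\mathcal{W}}\to 2^{\mathcal{W}}$ with $C_\varphi(W)\subseteq W$ for all $W\subseteq\mathcal{W}$. It is path-independent if $C_\varphi(W\cup W')=C_\varphi(C_\varphi(W)\cup W')$ for all $W,W'\subseteq\mathcal{W}$. Each worker $w$ has a strict linear order $P_w$ on $\Phi\cup\{\emptyset\}$, where $\emptyset$ stands for being unmatched. **Aizerman–Malishevski decomposition.** For firm $\varphi_i$ this is a finite sequence $(P_{ij})_{j\in J_i}$, $J_i=\{1,\dots,|J_i|\}$, of strict linear orders on $\mathcal{W}\cup\{\emptyset\}$ such that $C_{\varphi_i}(S)=\bigcup_{j\in J_i}\max_S P_{ij}$ for all $S\subseteq\mathcal{W}$. Here $\max_S P_{ij}$ is the singleton of the $P_{ij}$-best worker of $S$ if that worker is preferred to $\emptyset$, and is empty if no worker in $S$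 is preferred to $\emptyset$. Such a sequence exists if and only if $C_{\varphi_i}$ is path-independent. **Associated one-to-one market $M$.** The firm-copies are $\mathcal{F}=\{f_{ij}: i\in I, j\in J_i\}$; copy $f_{ij}$ has preference $P_{ij}$ (also written $P_{f_{ij}}$). Each worker $w$ has a strict linear order $\overline{P}_w$ on $\mathcal{F}\cup\{\emptyset\}$ such that: (1) $\varphi_iP_w\varphi_{i'}$ implies $f_{ij}\overline{P}_wf_{i'j'}$ for all $j\in J_i$, $j'\in J_{i'}$, and likewise each $f_{ij}$ is on the same side of $\emptyset$ in $\overline{P}_w$ as $\varphi_i$ is in $P_w$; (2) $f_{ij}\overline{P}_wf_{ij'}$ if and only if $j<j'$. A worker is acceptable to $f_{ij}$ if $P_{ij}$-preferred to $\emptyset$; a firm-copy is acceptable to $w$ if $\overline{P}_w$-preferred to $\emptyset$. A matching of $M$ is a map $\lambda:\mathcal{F}\cup\mathcal{W}\to\mathcal{F}\cup\mathcal{W}\cup\{\emptyset\}$ with $\lambda(f)\in\mathcal{W}\cup\{\emptyset\}$, $\lambda(w)\in\mathcal{F}\cup\{\emptyset\}$, and $\lambda(f)=w\iff\lambda(w)=f$. **Stability*.** $\lambda$ is blocked* by a worker $w$ if $\emptyset\,\overline{P}_w\,\lambda(w)$. It is blocked* by a firm-copy $f_{ij}$ if either $\emptyset P_{ij}\lambda(f_{ij})$, or $\lambda(f_{ij})\neq\emptyset$ and there is $j'\in J_i$ with $\lambda(f_{ij'})P_{ij}\lambda(f_{ij})$. It is blocked* by a pair $(f_{ij},w)$ if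 $f_{ij}\overline{P}_w\lambda(w)$ and $wP_{ij}\lambda(f_{ij'})$ for each $j'\in J_i$. $\lambda$ is stable* if it is not blocked* by any worker, any firm-copy, or any pair (firm-copy, worker). **Adapted firm-copies-proposing deferred acceptance algorithm.** Start with $\lambda^0\equiv\emptyset$. Let $O^k_w$ be the set of firm-copies making an offer to $w$ at stage $k$. Stage 1. (a) Each firm-copy $f$ makes an offer to its best acceptable worker according to $P_f$ (if any). (b) Each worker $w$ selects the $\overline{P}_w$-best element $\widetilde f$ of $O^1_w\cup\{\lambda^0(w)\}$, where $\lambda^0(w)=\emptyset$. Let $R^1_w=O^1_w\setminus\{\widetilde f\}$ (the rejected copies). Set $\lambda^1(f_{ij})=w$ if $f_{ij}$ is the copy selected by $w$, and $\lambda^1(f_{ij})=\emptyset$ otherwise. Stage $k\ge 2$. (a) Each firm-copy $f_{ij}\in\bigcup_{\widetilde w\in\mathcal{W}}R^{k-1}_{\widetilde w}$ considers the $P_{ij}$-best acceptable worker $w$ who has not previously rejected it (if there is none it makes no offer). It is authorized to make, and makes, an offer to $w$ if there are no $f_{ij'}$ (copy of the same firm) and $w'\ne w$ with $\lambda^{k-1}(w')=f_{ij'}$ and $w'P_{ij}w$. Otherwise $f_{ij}$ is unauthorized to make an offer at this stage. (b) Each worker $w$ selects the $\overline{P}_w$-best element $\widetilde f$ of $O^k_w\cup\{\lambda^{k-1}(w)\}$. Let $R^k_w$ be the set of firm-copies in $(O^k_w\cup\{\lambda^{k-1}(w)\})\setminus\{\widetilde f\}$. Set $\lambda^k(f_{ij})=\emptyset$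 if $f_{ij}\in\bigcup_wR^k_w$ or if $f_{ij}$ was unauthorized at this stage; $\lambda^k(f_{ij})=w$ if $f_{ij}$ is the copy selected by $w$; and $\lambda^k(f_{ij})=\lambda^{k-1}(f_{ij})$ otherwise. If $\bigcup_wR^k_w=\emptyset$, stop and output $\lambda_{\mathcal{F}}=\lambda^k$; otherwise go to stage $k+1$. At every stage $\lambda^k(w)=f$ if $\lambda^k(f)=w$, and $\lambda^k(w)=\emptyset$ if there is no such $f$.
   Formalization: As literally described, a firm-copy unauthorized at a stage never acts again, and the output can then fail to be stable*; here the copies considered at stage k ≥ 2 are those rejected at stage k−1 together with those unauthorized at stage k−1. *)

theory Defs
  imports Main
begin

text \<open>
  Preferences are strict linear orders on agents together with \<^term>\<open>None\<close>, which stands for being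
  unmatched; \<^prop>\<open>(x, y) \<in> P\<close> means that \<open>x\<close> is strictly preferred to \<open>y\<close>.
\<close>

definition preference_on :: "'a set \<Rightarrow> 'a option rel \<Rightarrow> bool" where
  "preference_on A P \<longleftrightarrow>
     P \<subseteq> insert None (Some ` A) \<times> insert None (Some ` A) \<and>
     strict_linear_order_on (insert None (Some ` A)) P"

definition max_pref :: "'a option rel \<Rightarrow> 'a set \<Rightarrow> 'a set" where
  "max_pref P S =
     {x \<in> S. (Some x, None) \<in> P \<and> (\<forall>y\<in>S. y \<noteq> x \<longrightarrow> (Some x, Some y) \<in> P)}"

definition best :: "'a rel \<Rightarrow> 'a set \<Rightarrow> 'a" where
  "best P A = (THE x. x \<in> A \<and> (\<forall>y\<in>A. y \<noteq> x \<longrightarrow> (x, y) \<in> P))"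


section \<open>Many-to-one markets\<close>

definition choice_function :: "'w set \<Rightarrow> ('w set \<Rightarrow> 'w set) \<Rightarrow> bool" where
  "choice_function W C \<longleftrightarrow> (\<forall>S\<subseteq>W. C S \<subseteq> S)"

definition path_independent :: "'w set \<Rightarrow> ('w set \<Rightarrow> 'w set) \<Rightarrow> bool" where
  "path_independent W C \<longleftrightarrow> (\<forall>S\<subseteq>W. \<forall>T\<subseteq>W. C (S \<union> T) = C (C S \<union> T))"

definition many_to_one_market ::
  "'f set \<Rightarrow> 'w set \<Rightarrow> ('f \<Rightarrow> 'w set \<Rightarrow> 'w set) \<Rightarrow> ('w \<Rightarrow> 'f option rel) \<Rightarrow> bool" where
  "many_to_one_market \<Phi> W C P \<longleftrightarrow>
     finite \<Phi> \<and> finite W \<and>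
     (\<forall>\<phi>\<in>\<Phi>. choice_function W (C \<phi>)) \<and>
     (\<forall>w\<in>W. preference_on \<Phi> (P w))"

text \<open>A decomposition is a sequence of length \<open>n\<close>, indexed by \<open>{1..n}\<close>.\<close>

definition am_decomposition ::
  "'w set \<Rightarrow> ('w set \<Rightarrow> 'w set) \<Rightarrow> nat \<Rightarrow> (nat \<Rightarrow> 'w option rel) \<Rightarrow> bool" where
  "am_decomposition W C n D \<longleftrightarrow>
     (\<forall>j\<in>{1..n}. preference_on W (D j)) \<and>
     (\<forall>S\<subseteq>W. C S = (\<Union>j\<in>{1..n}. max_pref (D j) S))"


section \<open>One-to-one markets of firm-copies and workers\<close>

text \<open>The \<open>j\<close>-th copy of firm \<open>\<phi>\<close> is the pair \<open>(\<phi>, j)\<close>.\<close>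

record ('f, 'w) copy_market =
  copies :: "('f \<times> nat) set"
  workers :: "'w set"
  wpref :: "'w \<Rightarrow> ('f \<times> nat) option rel"
  cpref :: "'f \<times> nat \<Rightarrow> 'w option rel"

definition firm_copies :: "'f set \<Rightarrow> ('f \<Rightarrow> nat) \<Rightarrow> ('f \<times> nat) set" where
  "firm_copies \<Phi> J = (SIGMA \<phi>:\<Phi>. {1..J \<phi>})"

definition associated_preference ::
  "'f set \<Rightarrow> ('f \<Rightarrow> nat) \<Rightarrow> 'f option rel \<Rightarrow> ('f \<times> nat) option rel \<Rightarrow> bool" where
  "associated_preference \<Phi> J P Q \<longleftrightarrow>
     preference_on (firm_copies \<Phi> J) Q \<and>
     (\<forall>\<phi>\<in>\<Phi>. \<forall>\<phi>'\<in>\<Phi>. (Some \<phi>, Some \<phi>') \<in> P \<longrightarrow>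
        (\<forall>j\<in>{1..J \<phi>}. \<forall>j'\<in>{1..J \<phi>'}. (Some (\<phi>, j), Some (\<phi>', j')) \<in> Q)) \<and>
     (\<forall>\<phi>\<in>\<Phi>. \<forall>j\<in>{1..J \<phi>}.
        ((Some (\<phi>, j), None) \<in> Q \<longleftrightarrow> (Some \<phi>, None) \<in> P) \<and>
        ((None, Some (\<phi>, j)) \<in> Q \<longleftrightarrow> (None, Some \<phi>) \<in> P)) \<and>
     (\<forall>\<phi>\<in>\<Phi>. \<forall>j\<in>{1..J \<phi>}. \<forall>j'\<in>{1..J \<phi>}.
        (Some (\<phi>, j), Some (\<phi>, j')) \<in> Q \<longleftrightarrow> j < j')"

definition same_firm :: "('f, 'w) copy_market \<Rightarrow> 'f \<times> nat \<Rightarrow> ('f \<times> nat) set" where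
  "same_firm M f = {f' \<in> copies M. fst f' = fst f}"

text \<open>
  A matching, as a map on the disjoint union of firm-copies and workers, is represented by the pair
  of its restrictions to firm-copies and to workers.
\<close>

type_synonym ('f, 'w) matching =
  "('f \<times> nat \<Rightarrow> 'w option) \<times> ('w \<Rightarrow> ('f \<times> nat) option)"

definition is_matching :: "('f, 'w) copy_market \<Rightarrow> ('f, 'w) matching \<Rightarrow> bool" where
  "is_matching M l \<longleftrightarrow>
     (\<forall>f\<in>copies M. fst l f \<in> insert None (Some ` workers M)) \<and>
     (\<forall>w\<in>workers M. snd l w \<in> insert None (Some ` copies M)) \<and>
     (\<forall>f\<in>copies M. \<forall>w\<in>workers M. fst l f = Some w \<longleftrightarrow> snd l w = Some f)"


section \<open>Stability*\<close>

definition blocked_by_worker ::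
  "('f, 'w) copy_market \<Rightarrow> ('f, 'w) matching \<Rightarrow> 'w \<Rightarrow> bool" where
  "blocked_by_worker M l w \<longleftrightarrow> (None, snd l w) \<in> wpref M w"

definition blocked_by_copy ::
  "('f, 'w) copy_market \<Rightarrow> ('f, 'w) matching \<Rightarrow> 'f \<times> nat \<Rightarrow> bool" where
  "blocked_by_copy M l f \<longleftrightarrow>
     (None, fst l f) \<in> cpref M f \<or>
     (fst l f \<noteq> None \<and> (\<exists>f'\<in>same_firm M f. (fst l f', fst l f) \<in> cpref M f))"

definition blocked_by_pair ::
  "('f, 'w) copy_market \<Rightarrow> ('f, 'w) matching \<Rightarrow> 'f \<times> nat \<Rightarrow> 'w \<Rightarrow> bool" where
  "blocked_by_pair M l f w \<longleftrightarrow>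
     (Some f, snd l w) \<in> wpref M w \<and>
     (\<forall>f'\<in>same_firm M f. (Some w, fst l f') \<in> cpref M f)"

definition stable_star :: "('f, 'w) copy_market \<Rightarrow> ('f, 'w) matching \<Rightarrow> bool" where
  "stable_star M l \<longleftrightarrow>
     (\<forall>w\<in>workers M. \<not> blocked_by_worker M l w) \<and>
     (\<forall>f\<in>copies M. \<not> blocked_by_copy M l f) \<and>
     (\<forall>f\<in>copies M. \<forall>w\<in>workers M. \<not> blocked_by_pair M l f w)"


section \<open>The adapted firm-copies-proposing deferred acceptance algorithm\<close>

text \<open>
  The state after a stage: \<open>assg\<close> is the current assignment of the firm-copies, \<open>rej w\<close> the set of
  copies rejected by \<open>w\<close> at that stage, \<open>past_rej w\<close> the set of copies rejected by \<open>w\<close> at that or an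
  earlier stage, and \<open>active\<close> the set of copies that consider a worker at the next stage.
\<close>

record ('f, 'w) da_state =
  assg :: "'f \<times> nat \<Rightarrow> 'w option"
  rej :: "'w \<Rightarrow> ('f \<times> nat) set"
  past_rej :: "'w \<Rightarrow> ('f \<times> nat) set"
  active :: "('f \<times> nat) set"

definition worker_side ::
  "('f, 'w) copy_market \<Rightarrow> ('f \<times> nat \<Rightarrow> 'w option) \<Rightarrow> 'w \<Rightarrow> ('f \<times> nat) option" where
  "worker_side M m w =
     (if \<exists>f\<in>copies M. m f = Some w then Some (THE f. f \<in> copies M \<and> m f = Some w) else None)"

text \<open>The set of considered workers is a singleton or empty.\<close>

definition considered ::
  "('f, 'w) copy_market \<Rightarrow> ('f, 'w) da_state \<Rightarrow> 'f \<times> nat \<Rightarrow> 'w set" where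
  "considered M s f = max_pref (cpref M f) {w \<in> workers M. f \<notin> past_rej s w}"

definition authorized ::
  "('f, 'w) copy_market \<Rightarrow> ('f, 'w) da_state \<Rightarrow> 'f \<times> nat \<Rightarrow> 'w \<Rightarrow> bool" where
  "authorized M s f w \<longleftrightarrow>
     \<not> (\<exists>f'\<in>same_firm M f. \<exists>w'\<in>workers M. w' \<noteq> w \<and>
          worker_side M (assg s) w' = Some f' \<and> (Some w', Some w) \<in> cpref M f)"

definition offers ::
  "('f, 'w) copy_market \<Rightarrow> ('f, 'w) da_state \<Rightarrow> 'w \<Rightarrow> ('f \<times> nat) set" where
  "offers M s w = {f \<in> active s. w \<in> considered M s f \<and> authorized M s f w}"

definition unauthorized ::
  "('f, 'w) copy_market \<Rightarrow> ('f, 'w) da_state \<Rightarrow> ('f \<times> nat) set" where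
  "unauthorized M s = {f \<in> active s. \<exists>w\<in>considered M s f. \<not> authorized M s f w}"

definition options_of ::
  "('f, 'w) copy_market \<Rightarrow> ('f, 'w) da_state \<Rightarrow> 'w \<Rightarrow> ('f \<times> nat) option set" where
  "options_of M s w = insert (worker_side M (assg s) w) (Some ` offers M s w)"

definition selected ::
  "('f, 'w) copy_market \<Rightarrow> ('f, 'w) da_state \<Rightarrow> 'w \<Rightarrow> ('f \<times> nat) option" where
  "selected M s w = best (wpref M w) (options_of M s w)"

definition rejected ::
  "('f, 'w) copy_market \<Rightarrow> ('f, 'w) da_state \<Rightarrow> 'w \<Rightarrow> ('f \<times> nat) set" where
  "rejected M s w = {f. Some f \<in> options_of M s w - {selected M s w}}"

definition new_assg ::
  "('f, 'w) copy_market \<Rightarrow> ('f, 'w) da_state \<Rightarrow> 'f \<times> nat \<Rightarrow> 'w option" where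
  "new_assg M s f =
     (if f \<in> (\<Union>w\<in>workers M. rejected M s w) \<union> unauthorized M s then None
      else if \<exists>w\<in>workers M. selected M s w = Some f
        then Some (THE w. w \<in> workers M \<and> selected M s w = Some f)
      else assg s f)"

text \<open>
  A lack of authorization only concerns the current stage: an unauthorized copy stays active and
  reconsiders its best remaining worker at the next stage. It cannot be dropped for good, since the
  copy of the same firm because of which it was unauthorized may itself be rejected later; the
  output would then in general not be stable*.
\<close>

definition da_step ::
  "('f, 'w) copy_market \<Rightarrow> ('f, 'w) da_state \<Rightarrow> ('f, 'w) da_state" where
  "da_step M s =
     \<lparr>assg = new_assg M s,
      rej = rejected M s,
      past_rej = (\<lambda>w. past_rej s w \<union> rejected M s w),
      active = (\<Union>w\<in>workers M. rejected M s w) \<union> unauthorized M s\<rparr>"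

text \<open>
  In the initial state all copies are active, nobody is matched and nobody has been rejected, so that
  at stage 1 every copy offers to its best acceptable worker and every offer is authorized.
\<close>

primrec da_stage :: "('f, 'w) copy_market \<Rightarrow> nat \<Rightarrow> ('f, 'w) da_state" where
  "da_stage M 0 =
     \<lparr>assg = (\<lambda>f. None), rej = (\<lambda>w. {}), past_rej = (\<lambda>w. {}), active = copies M\<rparr>"
| "da_stage M (Suc k) = da_step M (da_stage M k)"

definition stops_at :: "('f, 'w) copy_market \<Rightarrow> nat \<Rightarrow> bool" where
  "stops_at M k \<longleftrightarrow> 1 \<le> k \<and> (\<Union>w\<in>workers M. rej (da_stage M k) w) = {}"

definition da_output :: "('f, 'w) copy_market \<Rightarrow> ('f, 'w) matching" where
  "da_output M =
     (let m = assg (da_stage M (LEAST k. stops_at M k)) in (m, worker_side M m))"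

end

theory Submission
  imports Defs
begin

text \<open>
  Two facts carry the proof. A worker only ever trades up, so whoever was rejected by \<open>w\<close> stays below
  the current match of \<open>w\<close>. And if a copy \<open>f\<close> is held by \<open>w\<close> while its order puts \<open>w'\<close> above \<open>w\<close>, then
  \<open>w'\<close> has rejected \<open>f\<close> and is not held by a sister copy: this is what authorization guarantees at the
  time of the offer, and it persists because \<open>w'\<close> ranks all copies of a firm on the same side of any
  option foreign to that firm, so trading up never leads \<open>w'\<close> back to the firm of \<open>f\<close>. When no
  rejection occurs, the matches that make a copy unauthorized survive into the output, so an
  unmatched copy cannot take part in a blocking pair.
\<close>

section \<open>Best elements of finite sets under strict linear orders\<close>

lemma best_props:
  assumes P: "strict_linear_order_on A P" and B: "finite B" "B \<noteq> {}" "B \<subseteq> A"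
  shows "best P B \<in> B" "\<And>y. y \<in> B \<Longrightarrow> y \<noteq> best P B \<Longrightarrow> (best P B, y) \<in> P"
proof -
  have tr: "trans P" and ir: "irrefl P" and tot: "total_on A P"
    using P by (auto simp: strict_linear_order_on_def)
  from B have "\<exists>x\<in>B. \<forall>y\<in>B. y \<noteq> x \<longrightarrow> (x, y) \<in> P"
  proof (induction B rule: finite_ne_induct)
    case (singleton a)
    then show ?case by simp
  next
    case (insert a F)
    then obtain x where x: "x \<in> F" "\<forall>y\<in>F. y \<noteq> x \<longrightarrow> (x, y) \<in> P" by auto
    have "(x, a) \<in> P \<or> (a, x) \<in> P"
      using tot x insert by (auto simp: total_on_def)
    then show ?case
    proof
      assume "(x, a) \<in> P"
      then show ?thesis using x by blast
    next
      assume "(a, x) \<in> P"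
      then have "\<forall>y\<in>F. (a, y) \<in> P" using x(2) tr by (metis transD)
      then show ?thesis by blast
    qed
  qed
  then obtain x where x: "x \<in> B" "\<forall>y\<in>B. y \<noteq> x \<longrightarrow> (x, y) \<in> P" by blast
  \<comment> \<open>Two elements dominating all others would dominate each other, against
    transitivity and irreflexivity; so the definite description in \<open>best\<close> denotes
    \<open>x\<close>.\<close>
  have "best P B = x"
    unfolding best_def
  proof (rule the_equality)
    show "z = x" if "z \<in> B \<and> (\<forall>y\<in>B. y \<noteq> z \<longrightarrow> (z, y) \<in> P)" for z
      using that x tr ir by (metis transD irreflD)
  qed (use x in blast)
  then show "best P B \<in> B" "\<And>y. y \<in> B \<Longrightarrow> y \<noteq> best P B \<Longrightarrow> (best P B, y) \<in> P"
    using x by auto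
qed

lemma max_pref_unique:
  assumes "trans P" "irrefl P" "x \<in> max_pref P S" "y \<in> max_pref P S"
  shows "x = y"
proof (rule ccontr)
  assume "x \<noteq> y"
  then have "(Some x, Some y) \<in> P" "(Some y, Some x) \<in> P"
    using assms(3,4) by (auto simp: max_pref_def)
  then show False using assms(1,2) by (meson transD irreflD)
qed

text \<open>The best acceptable element of \<open>S\<close> also beats the unacceptable ones, by
  transitivity through \<open>None\<close>. Stability needs this: an unmatched copy with an
  acceptable worker left does consider someone.\<close>

lemma max_pref_exists:
  assumes P: "preference_on A P" and "finite S" "S \<subseteq> A" "x \<in> S" "(Some x, None) \<in> P"
  shows "max_pref P S \<noteq> {}"
proof -
  let ?B = "Some ` {y \<in> S. (Some y, None) \<in> P}"
  have slo: "strict_linear_order_on (insert None (Some ` A)) P"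
    using P by (simp add: preference_on_def)
  then have tr: "trans P" and tot: "total_on (insert None (Some ` A)) P"
    by (auto simp: strict_linear_order_on_def)
  have B: "finite ?B" "?B \<noteq> {}" "?B \<subseteq> insert None (Some ` A)"
    using assms by auto
  note b = best_props[OF slo B]
  from b(1) obtain z where z: "best P ?B = Some z" "z \<in> S" "(Some z, None) \<in> P" by auto
  have "(Some z, Some y) \<in> P" if y: "y \<in> S" "y \<noteq> z" for y
  proof (cases "(Some y, None) \<in> P")
    case True
    then show ?thesis using b(2)[of "Some y"] y z(1) by auto
  next
    case False
    then have "(None, Some y) \<in> P"
      using tot y assms(3) by (auto simp: total_on_def)
    then show ?thesis using transD[OF tr z(3)] by blast
  qed
  then show ?thesis using z unfolding max_pref_def by auto
qed

section \<open>Copy markets and the invariant of the algorithm\<close>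

text \<open>\<open>firm_block\<close> is the form in which the construction of the worker orders
  enters: a worker who turned down one copy for a foreign match will not accept an offer from a
  sister copy while that match is held.\<close>

locale firm_copy_market =
  fixes M :: "('f, 'w) copy_market"
  assumes finite_copies: "finite (copies M)"
    and finite_workers: "finite (workers M)"
    and wpref: "w \<in> workers M \<Longrightarrow> preference_on (copies M) (wpref M w)"
    and cpref: "f \<in> copies M \<Longrightarrow> preference_on (workers M) (cpref M f)"
    and firm_block: "\<lbrakk>w \<in> workers M; f \<in> copies M; f' \<in> copies M; fst f' = fst f;
      (x, Some f) \<in> wpref M w; \<And>g. x = Some g \<Longrightarrow> fst g \<noteq> fst f\<rbrakk>
      \<Longrightarrow> (x, Some f') \<in> wpref M w"
begin

lemma wpref_slo:
  "w \<in> workers M \<Longrightarrow> strict_linear_order_on (insert None (Some ` copies M)) (wpref M w)"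
  using wpref by (simp add: preference_on_def)

lemma wpref_trans:
  "\<lbrakk>w \<in> workers M; (x, y) \<in> wpref M w; (y, z) \<in> wpref M w\<rbrakk> \<Longrightarrow> (x, z) \<in> wpref M w"
  using wpref_slo by (meson strict_linear_order_on_def transD)

lemma wpref_irrefl: "w \<in> workers M \<Longrightarrow> (x, x) \<notin> wpref M w"
  using wpref_slo by (meson strict_linear_order_on_def irreflD)

lemma cpref_order: "f \<in> copies M \<Longrightarrow> trans (cpref M f) \<and> irrefl (cpref M f)"
  using cpref by (simp add: preference_on_def strict_linear_order_on_def)

lemma cpref_trans:
  "\<lbrakk>f \<in> copies M; (x, y) \<in> cpref M f; (y, z) \<in> cpref M f\<rbrakk> \<Longrightarrow> (x, z) \<in> cpref M f"
  using cpref_order by (meson transD)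

lemma cpref_irrefl: "f \<in> copies M \<Longrightarrow> (x, x) \<notin> cpref M f"
  using cpref_order by (meson irreflD)

text \<open>The first four conjuncts make the state a well-formed partial matching. The next two
  express that workers trade up, the seventh is the effect of authorization, and the last says that
  an idle unmatched copy has exhausted its acceptable workers.\<close>

definition da_invariant :: "('f, 'w) da_state \<Rightarrow> bool" where
  "da_invariant s \<longleftrightarrow>
     active s \<subseteq> copies M \<and>
     (\<forall>f\<in>active s. assg s f = None) \<and>
     (\<forall>f w. assg s f = Some w \<longrightarrow>
        f \<in> copies M \<and> w \<in> workers M \<and> (Some w, None) \<in> cpref M f) \<and>
     (\<forall>f f' w. assg s f = Some w \<longrightarrow> assg s f' = Some w \<longrightarrow> f = f') \<and>
     (\<forall>w\<in>workers M. worker_side M (assg s) w \<noteq> None \<longrightarrow>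
        (worker_side M (assg s) w, None) \<in> wpref M w) \<and>
     (\<forall>w\<in>workers M. \<forall>f\<in>past_rej s w.
        f \<in> copies M \<and> (worker_side M (assg s) w, Some f) \<in> wpref M w) \<and>
     (\<forall>f w. \<forall>w'\<in>workers M. assg s f = Some w \<longrightarrow> (Some w', Some w) \<in> cpref M f \<longrightarrow>
        f \<in> past_rej s w' \<and> (\<forall>f'. assg s f' = Some w' \<longrightarrow> fst f' \<noteq> fst f)) \<and>
     (\<forall>f\<in>copies M. assg s f = None \<longrightarrow> f \<notin> active s \<longrightarrow> considered M s f = {})"

lemma da_invariantD:
  assumes "da_invariant s"
  shows active_copies: "f \<in> active s \<Longrightarrow> f \<in> copies M"
    and active_unassigned: "f \<in> active s \<Longrightarrow> assg s f = None"
    and assg_copies: "assg s f = Some w \<Longrightarrow> f \<in> copies M"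
    and assg_workers: "assg s f = Some w \<Longrightarrow> w \<in> workers M"
    and assg_acceptable: "assg s f = Some w \<Longrightarrow> (Some w, None) \<in> cpref M f"
    and assg_inj: "assg s f = Some w \<Longrightarrow> assg s f' = Some w \<Longrightarrow> f = f'"
    and worker_acceptable: "w \<in> workers M \<Longrightarrow> worker_side M (assg s) w \<noteq> None \<Longrightarrow>
      (worker_side M (assg s) w, None) \<in> wpref M w"
    and past_rej_copies: "w \<in> workers M \<Longrightarrow> f \<in> past_rej s w \<Longrightarrow> f \<in> copies M"
    and past_rej_worse: "w \<in> workers M \<Longrightarrow> f \<in> past_rej s w \<Longrightarrow>
      (worker_side M (assg s) w, Some f) \<in> wpref M w"
    and better_rejected: "assg s f = Some w \<Longrightarrow> w' \<in> workers M \<Longrightarrow>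
      (Some w', Some w) \<in> cpref M f \<Longrightarrow> f \<in> past_rej s w'"
    and better_foreign: "assg s f = Some w \<Longrightarrow> w' \<in> workers M \<Longrightarrow>
      (Some w', Some w) \<in> cpref M f \<Longrightarrow> assg s f' = Some w' \<Longrightarrow> fst f' \<noteq> fst f"
    and inactive_exhausted: "f \<in> copies M \<Longrightarrow> assg s f = None \<Longrightarrow> f \<notin> active s \<Longrightarrow>
      considered M s f = {}"
  using assms by (simp_all only: da_invariant_def) blast+

text \<open>By the invariant only copies of the market are matched and no two hold the same worker,
  so the definite description in \<open>worker_side\<close> denotes the holder.\<close>

lemma worker_side_iff:
  assumes "da_invariant s"
  shows "worker_side M (assg s) w = Some f \<longleftrightarrow> assg s f = Some w"
proof (cases "\<exists>g. assg s g = Some w")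
  case True
  then obtain g where g: "assg s g = Some w" by blast
  have "(THE f. f \<in> copies M \<and> assg s f = Some w) = g"
    using g assg_inj[OF assms] assg_copies[OF assms] by (intro the_equality) blast+
  moreover have "\<exists>f\<in>copies M. assg s f = Some w"
    using g assg_copies[OF assms] by blast
  ultimately have "worker_side M (assg s) w = Some g"
    by (simp add: worker_side_def)
  then show ?thesis using g assg_inj[OF assms g] by (metis option.inject)
next
  case False
  then have "\<not> (\<exists>f\<in>copies M. assg s f = Some w)" by blast
  then have "worker_side M (assg s) w = None" unfolding worker_side_def by (rule if_not_P)
  moreover have "assg s f \<noteq> Some w" using False by blast
  ultimately show ?thesis by simp
qed

section \<open>Offers, selections and rejections within one stage\<close>

lemma consideredD:
  assumes "w \<in> considered M s f"
  shows "w \<in> workers M" "f \<notin> past_rej s w" "(Some w, None) \<in> cpref M f"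
    "\<And>w'. w' \<in> workers M \<Longrightarrow> f \<notin> past_rej s w' \<Longrightarrow> w' \<noteq> w \<Longrightarrow> (Some w, Some w') \<in> cpref M f"
  using assms by (auto simp: considered_def max_pref_def)

lemma considered_unique:
  assumes "f \<in> copies M" "w \<in> considered M s f" "w' \<in> considered M s f"
  shows "w = w'"
  using max_pref_unique[of "cpref M f" w _ w'] cpref_order[OF assms(1)] assms(2,3)
  unfolding considered_def by blast

lemma offersD:
  assumes "f \<in> offers M s w"
  shows "f \<in> active s" "w \<in> considered M s f" "authorized M s f w"
  using assms by (auto simp: offers_def)

lemma options_cases:
  assumes "da_invariant s" "Some f \<in> options_of M s w"
  obtains "assg s f = Some w" | "f \<in> offers M s w"
  using assms(2) worker_side_iff[OF assms(1), of w f] by (auto simp: options_of_def)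

text \<open>Active copies are unmatched, so a copy cannot be held and make an offer at once, and it
  considers at most one worker. This makes the choice of a worker in \<open>new_assg\<close>
  unambiguous.\<close>

lemma options_unique:
  assumes "da_invariant s" "Some f \<in> options_of M s w" "Some f \<in> options_of M s w'"
  shows "w = w'"
proof (rule options_cases[OF assms(1,2)]; rule options_cases[OF assms(1,3)])
  note unassigned = active_unassigned[OF assms(1), of f]
  show "w = w'" if "f \<in> offers M s w" "assg s f = Some w'"
    using unassigned that by (auto dest: offersD)
  show "w = w'" if "assg s f = Some w" "f \<in> offers M s w'"
    using unassigned that by (auto dest: offersD)
  assume "f \<in> offers M s w" "f \<in> offers M s w'"
  then show ?thesis
    using considered_unique active_copies[OF assms(1)] by (meson offersD)
qed simp

lemma options_copies:
  assumes "da_invariant s" "Some f \<in> options_of M s w"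
  shows "f \<in> copies M"
  using assms by (rule options_cases) (auto dest: offersD active_copies[OF assms(1)] assg_copies[OF assms(1)])

text \<open>A held copy rejected earlier would rank strictly below itself, and an offering copy
  considers only workers who have not rejected it. Hence every rejection is new, which drives
  termination.\<close>

lemma option_not_past_rej:
  assumes "da_invariant s" "w \<in> workers M" "Some f \<in> options_of M s w"
  shows "f \<notin> past_rej s w"
  using assms(1,3)
proof (cases rule: options_cases)
  case 1
  then show ?thesis
    using past_rej_worse[OF assms(1,2), of f] wpref_irrefl[OF assms(2)]
      worker_side_iff[OF assms(1)] by metis
next
  case 2
  then show ?thesis by (meson offersD consideredD)
qed

lemma
  assumes "da_invariant s" "w \<in> workers M"
  shows selected_option: "selected M s w \<in> options_of M s w"
    and selected_best: "\<And>x. x \<in> options_of M s w \<Longrightarrow> x \<noteq> selected M s w \<Longrightarrow>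
      (selected M s w, x) \<in> wpref M w"
proof -
  have sub: "options_of M s w \<subseteq> insert None (Some ` copies M)"
  proof
    fix x assume "x \<in> options_of M s w"
    then show "x \<in> insert None (Some ` copies M)"
      using options_copies[OF assms(1)] by (cases x) auto
  qed
  have "options_of M s w \<noteq> {}" by (simp add: options_of_def)
  note b = best_props[OF wpref_slo[OF assms(2)] finite_subset[OF sub] this sub]
  show "selected M s w \<in> options_of M s w"
    "\<And>x. x \<in> options_of M s w \<Longrightarrow> x \<noteq> selected M s w \<Longrightarrow> (selected M s w, x) \<in> wpref M w"
    using b finite_copies unfolding selected_def by auto
qed

text \<open>The current match is itself one of the options, so no worker trades down.\<close>

lemma selected_improves:
  assumes "da_invariant s" "w \<in> workers M"
  shows "selected M s w = worker_side M (assg s) w \<or>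
    (selected M s w, worker_side M (assg s) w) \<in> wpref M w"
  using selected_best[OF assms, of "worker_side M (assg s) w"] by (fastforce simp: options_of_def)

lemma rejected_iff:
  "f \<in> rejected M s w \<longleftrightarrow> Some f \<in> options_of M s w \<and> selected M s w \<noteq> Some f"
  by (auto simp: rejected_def)

text \<open>A copy retained without rejection is still an option of its worker, hence the selected
  one. Conversely, a selected copy is an option of one worker only, so it is rejected nowhere, and
  being held or authorized it is not unauthorized.\<close>

lemma new_assg_iff:
  assumes inv: "da_invariant s"
  shows "new_assg M s f = Some w \<longleftrightarrow> w \<in> workers M \<and> selected M s w = Some f"
proof
  assume l: "new_assg M s f = Some w"
  have nr: "f \<notin> (\<Union>w\<in>workers M. rejected M s w) \<union> unauthorized M s"
    using l unfolding new_assg_def by (auto split: if_splits)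
  show "w \<in> workers M \<and> selected M s w = Some f"
  proof (cases "\<exists>w\<in>workers M. selected M s w = Some f")
    case True
    have "\<exists>!w. w \<in> workers M \<and> selected M s w = Some f"
      using True selected_option[OF inv] options_unique[OF inv] by metis
    then have "(THE w. w \<in> workers M \<and> selected M s w = Some f) \<in> workers M \<and>
      selected M s (THE w. w \<in> workers M \<and> selected M s w = Some f) = Some f"
      by (rule theI')
    then show ?thesis using l nr True unfolding new_assg_def by auto
  next
    case False
    then have a: "assg s f = Some w"
      using l nr unfolding new_assg_def by (auto split: if_splits)
    then have "w \<in> workers M" using assg_workers[OF inv] by blast
    moreover have "Some f \<in> options_of M s w"
      using a worker_side_iff[OF inv, of w f] by (simp add: options_of_def)
    ultimately show ?thesis using nr rejected_iff by blast
  qed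
next
  assume r: "w \<in> workers M \<and> selected M s w = Some f"
  then have o: "Some f \<in> options_of M s w" using selected_option[OF inv] by metis
  have "f \<notin> rejected M s w'" for w'
    using options_unique[OF inv o] r by (auto simp: rejected_iff)
  moreover have "f \<notin> unauthorized M s"
    using inv o
  proof (cases rule: options_cases)
    case 1
    then show ?thesis using active_unassigned[OF inv, of f] by (auto simp: unauthorized_def)
  next
    case 2
    then show ?thesis
      using considered_unique active_copies[OF inv] offersD
      unfolding unauthorized_def by blast
  qed
  moreover have "(THE w. w \<in> workers M \<and> selected M s w = Some f) = w"
    using r selected_option[OF inv] options_unique[OF inv o]
    by (intro the_equality) metis+
  ultimately show "new_assg M s f = Some w"
    using r unfolding new_assg_def by auto
qed

lemma worker_side_new_assg:
  assumes inv: "da_invariant s" and w: "w \<in> workers M"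
  shows "worker_side M (new_assg M s) w = selected M s w"
proof (cases "selected M s w")
  case None
  then show ?thesis
    using new_assg_iff[OF inv] by (auto simp: worker_side_def)
next
  case (Some f)
  have "f \<in> copies M"
    using Some selected_option[OF inv w] options_copies[OF inv] by metis
  moreover have "(THE f. f \<in> copies M \<and> new_assg M s f = Some w) = f"
    using Some w \<open>f \<in> copies M\<close> by (intro the_equality) (auto simp: new_assg_iff[OF inv])
  ultimately show ?thesis
    using Some w by (auto simp: worker_side_def new_assg_iff[OF inv])
qed

section \<open>Preservation of the invariant\<close>

text \<open>If \<open>f\<close> was already held by \<open>w\<close>, the old invariant applies; if
  \<open>f\<close> has just offered to \<open>w\<close>, its choice of \<open>w\<close> and its
  authorization give the same facts about the old state. Only the second claim must then be carried
  over to the new assignment.\<close>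

lemma new_assg_better:
  assumes inv: "da_invariant s" and a: "new_assg M s f = Some w"
    and w': "w' \<in> workers M" "(Some w', Some w) \<in> cpref M f"
  shows "f \<in> past_rej s w'" and "new_assg M s f' = Some w' \<Longrightarrow> fst f' \<noteq> fst f"
proof -
  have w: "w \<in> workers M" and o: "Some f \<in> options_of M s w"
    using a selected_option[OF inv] unfolding new_assg_iff[OF inv] by metis+
  then have f: "f \<in> copies M" using options_copies[OF inv] by blast
  have "w' \<noteq> w" using w' cpref_irrefl[OF f] by blast
  have old: "f \<in> past_rej s w' \<and> (\<forall>g. assg s g = Some w' \<longrightarrow> fst g \<noteq> fst f)"
    using inv o
  proof (cases rule: options_cases)
    case 1
    then show ?thesis
      using better_rejected[OF inv] better_foreign[OF inv] w' by blast
  next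
    case 2
    \<comment> \<open>\<open>w\<close> is the best worker that has not rejected \<open>f\<close>, so
      any better one has.\<close>
    have "f \<in> past_rej s w'"
      using consideredD(4)[OF offersD(2)[OF 2] w'(1) _ \<open>w' \<noteq> w\<close>] w'(2)
        cpref_trans[OF f] cpref_irrefl[OF f] by blast
    moreover have "fst g \<noteq> fst f" if "assg s g = Some w'" for g
      using offersD(3)[OF 2] w' \<open>w' \<noteq> w\<close> that assg_copies[OF inv that]
      unfolding authorized_def same_firm_def worker_side_iff[OF inv] by blast
    ultimately show ?thesis by blast
  qed
  then show "f \<in> past_rej s w'" by blast
  show "fst f' \<noteq> fst f" if n: "new_assg M s f' = Some w'"
  proof
    assume same: "fst f' = fst f"
    have sel: "selected M s w' = Some f'" using n new_assg_iff[OF inv] by blast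
    have f': "f' \<in> copies M"
      using sel selected_option[OF inv w'(1)] options_copies[OF inv] by metis
    \<comment> \<open>The old match of \<open>w'\<close> beats \<open>f\<close>, which
      \<open>w'\<close> rejected, and is foreign to the firm of \<open>f\<close>; so it beats the
      sister copy \<open>f'\<close> too, and \<open>w'\<close> cannot have selected
      \<open>f'\<close>.\<close>
    have "(worker_side M (assg s) w', Some f') \<in> wpref M w'"
      using firm_block[OF w'(1) f f' same past_rej_worse[OF inv w'(1)]] old
        worker_side_iff[OF inv] by blast
    then show False
      using selected_improves[OF inv w'(1)] sel wpref_trans[OF w'(1)] wpref_irrefl[OF w'(1)]
      by metis
  qed
qed

lemma da_invariant_initial: "da_invariant (da_stage M 0)"
  by (auto simp: da_invariant_def worker_side_def)

lemma da_invariant_step: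
  assumes inv: "da_invariant s"
  shows "da_invariant (da_step M s)"
proof -
  let ?s = "da_step M s"
  have sel: "assg ?s f = Some w \<longleftrightarrow> w \<in> workers M \<and> selected M s w = Some f" for f w
    by (simp add: da_step_def new_assg_iff[OF inv])
  have ws: "worker_side M (assg ?s) w = selected M s w" if "w \<in> workers M" for w
    using worker_side_new_assg[OF inv that] by (simp add: da_step_def)
  have opt: "w \<in> workers M \<and> Some f \<in> options_of M s w" if "assg ?s f = Some w" for f w
    using that sel selected_option[OF inv] by metis
  have "active ?s \<subseteq> copies M"
    using options_copies[OF inv] active_copies[OF inv]
    by (auto simp: da_step_def rejected_iff unauthorized_def)
  moreover have "assg ?s f = None" if "f \<in> active ?s" for f
    using that by (auto simp: da_step_def new_assg_def)
  moreover have "f \<in> copies M \<and> w \<in> workers M \<and> (Some w, None) \<in> cpref M f"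
    if a: "assg ?s f = Some w" for f w
  proof -
    have "(Some w, None) \<in> cpref M f"
      using inv conjunct2[OF opt[OF a]]
      by (cases rule: options_cases) (auto dest: assg_acceptable[OF inv] offersD consideredD)
    then show ?thesis using opt[OF a] options_copies[OF inv] by blast
  qed
  moreover have "f = f'" if "assg ?s f = Some w" "assg ?s f' = Some w" for f f' w
    using that sel by simp
  moreover have "(worker_side M (assg ?s) w, None) \<in> wpref M w"
    if w: "w \<in> workers M" and "worker_side M (assg ?s) w \<noteq> None" for w
    using selected_improves[OF inv w] worker_acceptable[OF inv w] wpref_trans[OF w] ws[OF w] that(2)
    by metis
  moreover have "f \<in> copies M \<and> (worker_side M (assg ?s) w, Some f) \<in> wpref M w"
    if w: "w \<in> workers M" and f: "f \<in> past_rej ?s w" for w f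
  proof (cases "f \<in> past_rej s w")
    case True
    then show ?thesis
      using past_rej_copies[OF inv w] past_rej_worse[OF inv w] selected_improves[OF inv w]
        wpref_trans[OF w] ws[OF w] by metis
  next
    case False
    \<comment> \<open>A fresh rejection is compared directly with the selected option; older ones
      were handled by trading up.\<close>
    then have "f \<in> rejected M s w" using f by (simp add: da_step_def)
    then show ?thesis
      using selected_best[OF inv w, of "Some f"] options_copies[OF inv, of f w] ws[OF w]
      by (auto simp: rejected_iff)
  qed
  moreover have "f \<in> past_rej ?s w' \<and> (\<forall>f'. assg ?s f' = Some w' \<longrightarrow> fst f' \<noteq> fst f)"
    if "w' \<in> workers M" "assg ?s f = Some w" "(Some w', Some w) \<in> cpref M f" for f w w'
    using new_assg_better[OF inv, of f w w'] that by (simp add: da_step_def)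
  moreover have "considered M ?s f = {}"
    if f: "f \<in> copies M" and a: "assg ?s f = None" and n: "f \<notin> active ?s" for f
  proof -
    have nr: "f \<notin> rejected M s w" if "w \<in> workers M" for w
      using n that by (auto simp: da_step_def)
    have nu: "f \<notin> unauthorized M s" using n by (simp add: da_step_def)
    have ns: "selected M s w \<noteq> Some f" if "w \<in> workers M" for w
      using a sel[of f w] that by simp
    \<comment> \<open>Neither rejected, unauthorized nor selected, \<open>f\<close> falls into the
      default case and keeps its old value.\<close>
    have "assg s f = None"
      using a nr nu ns by (auto simp: da_step_def new_assg_def split: if_splits)
    have "considered M s f = {}"
    proof (cases "f \<in> active s")
      case True
      have False if c: "w \<in> considered M s f" for w
      proof -
        \<comment> \<open>An active copy with a worker to consider, if not unauthorized, makes an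
          offer and is then selected or rejected, both of which are excluded here.\<close>
        have "f \<in> offers M s w"
          using True c nu by (auto simp: offers_def unauthorized_def)
        then show False
          using nr ns consideredD(1)[OF c] by (auto simp: rejected_iff options_of_def)
      qed
      then show ?thesis by blast
    next
      case False
      then show ?thesis using inactive_exhausted[OF inv f \<open>assg s f = None\<close>] by blast
    qed
    moreover have "{w \<in> workers M. f \<notin> past_rej ?s w} = {w \<in> workers M. f \<notin> past_rej s w}"
      using nr by (auto simp: da_step_def)
    ultimately show ?thesis by (simp add: considered_def)
  qed
  ultimately show ?thesis unfolding da_invariant_def by meson
qed

lemma da_invariant_stage: "da_invariant (da_stage M k)"
  by (induction k) (use da_invariant_initial in \<open>simp_all add: da_invariant_step\<close>)

section \<open>Termination\<close>

lemma da_terminates: "\<exists>k. stops_at M k"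
proof (rule ccontr)
  assume no: "\<nexists>k. stops_at M k"
  \<comment> \<open>The pairs of a worker and a copy it has rejected: without a stop, this set grows
    strictly at every stage inside a fixed finite product.\<close>
  let ?R = "\<lambda>k. SIGMA w:workers M. past_rej (da_stage M k) w"
  have sub: "?R k \<subseteq> workers M \<times> copies M" for k
    using past_rej_copies[OF da_invariant_stage] by blast
  have fin: "finite (workers M \<times> copies M)"
    using finite_workers finite_copies by simp
  have "k \<le> card (?R k)" for k
  proof (induction k)
    case (Suc k)
    let ?s = "da_stage M k"
    have "\<not> stops_at M (Suc k)" using no by blast
    then obtain w f where wf: "w \<in> workers M" "f \<in> rejected M ?s w"
      by (auto simp: stops_at_def da_step_def)
    have "f \<notin> past_rej ?s w"
      using option_not_past_rej[OF da_invariant_stage] wf by (auto simp: rejected_iff)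
    then have "?R k \<subset> ?R (Suc k)"
      using wf by (auto simp: da_step_def)
    then have "card (?R k) < card (?R (Suc k))"
      by (rule psubset_card_mono[OF finite_subset[OF sub fin]])
    then show ?case using Suc by simp
  qed simp
  then have "Suc (card (workers M \<times> copies M)) \<le> card (workers M \<times> copies M)"
    using card_mono[OF fin sub] order_trans by blast
  then show False by simp
qed

section \<open>Stability of the output\<close>

lemma is_matching_invariant:
  assumes "da_invariant s"
  shows "is_matching M (assg s, worker_side M (assg s))"
proof -
  have "assg s f \<in> insert None (Some ` workers M)" for f
    using assg_workers[OF assms] by (cases "assg s f") auto
  moreover have "worker_side M (assg s) w \<in> insert None (Some ` copies M)" for w
    using assg_copies[OF assms] worker_side_iff[OF assms]
    by (cases "worker_side M (assg s) w") auto
  ultimately show ?thesis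
    using worker_side_iff[OF assms] by (auto simp: is_matching_def)
qed

text \<open>The invariant of the new state excludes blocking by workers, by copies, and by pairs
  with a matched copy. The absence of rejections serves the remaining case: an unmatched copy lacked
  authorization because of a sister match that is still present in the output.\<close>

lemma stable_star_final:
  assumes inv: "da_invariant s" and final: "\<And>w. w \<in> workers M \<Longrightarrow> rejected M s w = {}"
  shows "stable_star M (assg (da_step M s), worker_side M (assg (da_step M s)))"
proof -
  let ?s = "da_step M s"
  have inv': "da_invariant ?s" using inv by (rule da_invariant_step)
  have kept: "assg ?s f = Some w" if a: "assg s f = Some w" for f w
  proof -
    have "w \<in> workers M" using assg_workers[OF inv a] .
    moreover have "Some f \<in> options_of M s w"
      using a worker_side_iff[OF inv, of w f] by (simp add: options_of_def)
    ultimately show ?thesis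
      using final[of w] rejected_iff[of f s w] by (simp add: da_step_def new_assg_iff[OF inv])
  qed
  have cons: "considered M ?s f = considered M s f" for f
  proof -
    have "{w \<in> workers M. f \<notin> past_rej ?s w} = {w \<in> workers M. f \<notin> past_rej s w}"
      using final by (auto simp: da_step_def)
    then show ?thesis by (simp add: considered_def)
  qed
  have "\<not> blocked_by_worker M (assg ?s, worker_side M (assg ?s)) w" if w: "w \<in> workers M" for w
    using worker_acceptable[OF inv' w] wpref_trans[OF w] wpref_irrefl[OF w]
    unfolding blocked_by_worker_def snd_conv by metis
  moreover have "\<not> blocked_by_copy M (assg ?s, worker_side M (assg ?s)) f"
    if f: "f \<in> copies M" for f
  proof
    assume b: "blocked_by_copy M (assg ?s, worker_side M (assg ?s)) f"
    obtain w where w: "assg ?s f = Some w"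
      using b cpref_irrefl[OF f, of None] by (cases "assg ?s f") (auto simp: blocked_by_copy_def)
    \<comment> \<open>This rules out the first way of blocking and also a sister copy that is
      unmatched, leaving a sister with a better worker.\<close>
    have none: "(None, assg ?s f) \<notin> cpref M f"
      using assg_acceptable[OF inv' w] w cpref_trans[OF f, of None "Some w" None]
        cpref_irrefl[OF f, of None] by auto
    then obtain f' where f': "fst f' = fst f" "(assg ?s f', Some w) \<in> cpref M f"
      using b w unfolding blocked_by_copy_def same_firm_def fst_conv by auto
    then obtain w' where "assg ?s f' = Some w'"
      using none w by (cases "assg ?s f'") auto
    with f' have "fst f' = fst f" "assg ?s f' = Some w'" "(Some w', Some w) \<in> cpref M f"
      by auto
    then show False
      using better_foreign[OF inv' w] assg_workers[OF inv'] by blast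
  qed
  moreover have "\<not> blocked_by_pair M (assg ?s, worker_side M (assg ?s)) f w"
    if f: "f \<in> copies M" and w: "w \<in> workers M" for f w
  proof
    assume "blocked_by_pair M (assg ?s, worker_side M (assg ?s)) f w"
    then have b: "(Some f, worker_side M (assg ?s) w) \<in> wpref M w"
      and pref: "\<And>f'. f' \<in> copies M \<Longrightarrow> fst f' = fst f \<Longrightarrow> (Some w, assg ?s f') \<in> cpref M f"
      by (auto simp: blocked_by_pair_def same_firm_def)
    \<comment> \<open>Past rejections rank below the match of \<open>w\<close>, whereas a blocking
      \<open>f\<close> ranks above it.\<close>
    have np: "f \<notin> past_rej ?s w"
      using past_rej_worse[OF inv' w] b wpref_trans[OF w] wpref_irrefl[OF w] by blast
    \<comment> \<open>A matched \<open>f\<close> preferring \<open>w\<close> to its own worker would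
      have been rejected by \<open>w\<close>.\<close>
    have "assg ?s f = None"
      using better_rejected[OF inv' _ w] pref[OF f] np by (cases "assg ?s f") auto
    then have acc: "(Some w, None) \<in> cpref M f" using pref[OF f] by simp
    have "considered M ?s f \<noteq> {}"
      unfolding considered_def
      using max_pref_exists[OF cpref[OF f], of "{w \<in> workers M. f \<notin> past_rej ?s w}" w]
        finite_workers w np acc by auto
    then have "f \<in> active ?s"
      using inactive_exhausted[OF inv' f \<open>assg ?s f = None\<close>] by blast
    \<comment> \<open>After a stage without rejections, only unauthorized copies remain
      active.\<close>
    then have "f \<in> unauthorized M s"
      using final by (auto simp: da_step_def)
    then obtain v where v: "v \<in> considered M s f" "\<not> authorized M s f v"
      by (auto simp: unauthorized_def)
    then obtain f' w' where f': "f' \<in> copies M" "fst f' = fst f" "assg s f' = Some w'"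
      "(Some w', Some v) \<in> cpref M f"
      by (auto simp: authorized_def same_firm_def worker_side_iff[OF inv])
    \<comment> \<open>\<open>v\<close> is the best worker left for \<open>f\<close> and
      \<open>w\<close> is still available, so the sister's worker \<open>w'\<close>, who beats
      \<open>v\<close>, also beats \<open>w\<close>. Blocking demands the reverse, since
      \<open>f'\<close> still holds \<open>w'\<close>.\<close>
    have "v = w \<or> (Some v, Some w) \<in> cpref M f"
      using consideredD(4)[of v ?s f w] v cons w np by auto
    then have "(Some w', Some w) \<in> cpref M f"
      using f'(4) cpref_trans[OF f] by blast
    moreover have "(Some w, Some w') \<in> cpref M f"
      using pref[OF f'(1,2)] kept[OF f'(3)] by simp
    ultimately show False
      using cpref_trans[OF f] cpref_irrefl[OF f] by blast
  qed
  ultimately show ?thesis by (simp add: stable_star_def)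
qed

theorem da_output_stable:
  "(\<exists>k. stops_at M k) \<and> is_matching M (da_output M) \<and> stable_star M (da_output M)"
proof -
  let ?k = "LEAST k. stops_at M k"
  have k: "stops_at M ?k" using da_terminates by (rule LeastI_ex)
  \<comment> \<open>\<open>stops_at\<close> requires at least one stage, so a state before the last
    stage exists, and the rejections recorded at \<open>Suc m\<close> are computed from the state at
    \<open>m\<close>.\<close>
  then obtain m where m: "?k = Suc m"
    by (cases ?k) (auto simp: stops_at_def)
  have "rejected M (da_stage M m) w = {}" if "w \<in> workers M" for w
    using k that unfolding m by (simp add: stops_at_def da_step_def)
  then have "stable_star M (da_output M)"
    using stable_star_final[OF da_invariant_stage] by (simp add: da_output_def Let_def m)
  then show ?thesis
    using da_terminates is_matching_invariant[OF da_invariant_stage]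
    by (auto simp: da_output_def Let_def)
qed

end

section \<open>From many-to-one markets to copy markets\<close>

text \<open>Comparing a copy with \<open>None\<close> or with a copy of another firm depends on the
  firms alone, so it has the same outcome for every copy of the firm.\<close>

lemma associated_preference_firm_block:
  assumes P: "preference_on \<Phi> P" and Q: "associated_preference \<Phi> J P Q"
    and f: "f \<in> firm_copies \<Phi> J" "f' \<in> firm_copies \<Phi> J" "fst f' = fst f"
    and x: "(x, Some f) \<in> Q" "\<And>g. x = Some g \<Longrightarrow> fst g \<noteq> fst f"
  shows "(x, Some f') \<in> Q"
proof -
  obtain \<phi> j where fj: "f = (\<phi>, j)" "\<phi> \<in> \<Phi>" "j \<in> {1..J \<phi>}"
    using f(1) by (auto simp: firm_copies_def)
  obtain j' where fj': "f' = (\<phi>, j')" "j' \<in> {1..J \<phi>}"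
    using f(2,3) fj by (auto simp: firm_copies_def)
  have pQ: "preference_on (firm_copies \<Phi> J) Q"
    and across: "\<And>\<phi> \<phi>' j j'. \<lbrakk>\<phi> \<in> \<Phi>; \<phi>' \<in> \<Phi>; (Some \<phi>, Some \<phi>') \<in> P; j \<in> {1..J \<phi>}; j' \<in> {1..J \<phi>'}\<rbrakk>
      \<Longrightarrow> (Some (\<phi>, j), Some (\<phi>', j')) \<in> Q"
    and none: "\<And>\<phi> j. \<lbrakk>\<phi> \<in> \<Phi>; j \<in> {1..J \<phi>}\<rbrakk>
      \<Longrightarrow> (None, Some (\<phi>, j)) \<in> Q \<longleftrightarrow> (None, Some \<phi>) \<in> P"
    using Q unfolding associated_preference_def by blast+
  show ?thesis
  proof (cases x)
    case None
    then show ?thesis using none x(1) fj fj' by blast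
  next
    case (Some g)
    then have "g \<in> firm_copies \<Phi> J"
      using pQ x(1) by (auto simp: preference_on_def)
    then obtain \<psi> i where g: "g = (\<psi>, i)" "\<psi> \<in> \<Phi>" "i \<in> {1..J \<psi>}"
      by (auto simp: firm_copies_def)
    have "\<psi> \<noteq> \<phi>" using x(2)[OF Some] g fj by simp
    then have "(Some \<psi>, Some \<phi>) \<in> P \<or> (Some \<phi>, Some \<psi>) \<in> P"
      using P g(2) fj(2) by (auto simp: preference_on_def strict_linear_order_on_def total_on_def)
    \<comment> \<open>Otherwise \<open>f\<close> would beat \<open>x\<close> in \<open>Q\<close>,
      contrary to the assumed comparison; by totality of \<open>P\<close>, \<open>\<psi>\<close> is
      then the better firm.\<close>
    moreover have "(Some \<phi>, Some \<psi>) \<notin> P"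
    proof
      assume "(Some \<phi>, Some \<psi>) \<in> P"
      then have "(Some f, x) \<in> Q" using across fj g Some by blast
      then show False
        using x(1) pQ unfolding preference_on_def strict_linear_order_on_def
        by (meson transD irreflD)
    qed
    ultimately show ?thesis using across fj fj' g Some by blast
  qed
qed

theorem theorem1:
  fixes \<Phi> :: "'f set" and W :: "'w set"
    and C :: "'f \<Rightarrow> 'w set \<Rightarrow> 'w set"
    and P :: "'w \<Rightarrow> 'f option rel"
    and J :: "'f \<Rightarrow> nat"
    and D :: "'f \<Rightarrow> nat \<Rightarrow> 'w option rel"
    and Q :: "'w \<Rightarrow> ('f \<times> nat) option rel"
    and M :: "('f, 'w) copy_market"
  assumes market: "many_to_one_market \<Phi> W C P"
    and path_independent: "\<And>\<phi>. \<phi> \<in> \<Phi> \<Longrightarrow> path_independent W (C \<phi>)"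
    and decomposition: "\<And>\<phi>. \<phi> \<in> \<Phi> \<Longrightarrow> am_decomposition W (C \<phi>) (J \<phi>) (D \<phi>)"
    and associated: "\<And>w. w \<in> W \<Longrightarrow> associated_preference \<Phi> J (P w) (Q w)"
    and M: "M = \<lparr>copies = firm_copies \<Phi> J, workers = W, wpref = Q,
                 cpref = (\<lambda>(\<phi>, j). D \<phi> j)\<rparr>"
  shows "(\<exists>k. stops_at M k) \<and>
         is_matching M (da_output M) \<and> stable_star M (da_output M)"
proof -
  have "firm_copy_market M"
  proof
    show "finite (copies M)" "finite (workers M)"
      using market by (auto simp: M many_to_one_market_def firm_copies_def)
    show "preference_on (copies M) (wpref M w)" if "w \<in> workers M" for w
      using associated that by (simp add: M associated_preference_def)
    show "preference_on (workers M) (cpref M f)" if "f \<in> copies M" for f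
      using decomposition that by (auto simp: M firm_copies_def am_decomposition_def)
    show "(x, Some f') \<in> wpref M w"
      if "w \<in> workers M" "f \<in> copies M" "f' \<in> copies M" "fst f' = fst f"
        "(x, Some f) \<in> wpref M w" "\<And>g. x = Some g \<Longrightarrow> fst g \<noteq> fst f" for w f f' x
      using associated_preference_firm_block[of \<Phi> "P w" J "Q w" f f' x] market associated that
      by (simp add: M many_to_one_market_def)
  qed
  then show ?thesis by (rule firm_copy_market.da_output_stable)
qed

end
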